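(* An operator $T:X\rightrightarrows X^{*}$ is maximal monotone if and only if $T$ is dual-representable and unique.
   Context: $X\neq\{0\}$ is a real separated (Hausdorff) locally convex space with topology $\tau$; $X^{*}$ is its topological dual endowed with the weak-star topology $w^{*}$. Put $Z:=X\times X^{*}$, $c(x,x^{*}):=\langle x,x^{*}\rangle:=x^{*}(x)$, and $z\cdot z':=\langle x,x'^{*}\rangle+\langle x',x^{*}\rangle$ for $z=(x,x^{*})$, $z'=(x',x'^{*})\in Z$. An operator $T:X\rightrightarrows X^{*}$ is identified with its graph $\{(x,x^{*}): x^{*}\in T(x)\}\subset Z$. A set $T\subset Z$ is monotone if $c(z-z')\ge 0$ for all $z,z'\in T$; it is maximal monotone if it is monotone and is not properly contained in another monotone subset of $Z$. $T$ is unique if $T$ is monotone and admits exactly one maximal monotone extension (i.e. there is exactly one maximal monotone $M\subset Z$ with $T\subset M$). For a function $f:Z\to\overline{\mathbb{R}}$, $f^{\square}(z):=\sup\{z\cdot z'-f(z')\mid z'\in Z\}$, and $[f=c]:=\{z\in Z\mid f(z)=c(z)\}$. $T$ is dual-representable if $T=[f=c]$ for some proper convex $\tau\times w^{*}$-lower semicontinuous $f:Z\to\overline{\mathbb{R}}$ with $f\ge c$ and $f^{\square}\ge c$ on $Z$. *)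

theory Defs
  imports "HOL-Analysis.Analysis"
begin

text \<open>Real Hausdorff locally convex spaces, the topology being the one of the type class.
  Joint continuity of the scalar multiplication is stated in the style of the library class
  \<open>topological_monoid_add\<close>. The constant \<open>convex\<close> is not available
  inside a class specification, so its definition is written out.\<close>

class locally_convex_space = real_vector + t2_space + topological_ab_group_add +
  assumes tendsto_scaleR_Pair:
      "LIM p (nhds r \<times>\<^sub>F nhds x). fst p *\<^sub>R snd p :> nhds (r *\<^sub>R x)"
    and locally_convex:
      "open U \<Longrightarrow> 0 \<in> U \<Longrightarrow>
        \<exists>V. open V \<and> 0 \<in> V \<and> V \<subseteq> U \<and>
          (\<forall>x\<in>V. \<forall>y\<in>V. \<forall>u\<ge>0. \<forall>v\<ge>0. u + v = 1 \<longrightarrow> u *\<^sub>R x + v *\<^sub>R y \<in> V)"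

lemma locally_convex_nbhd:
  fixes U :: "'a::locally_convex_space set"
  assumes "open U" "0 \<in> U"
  obtains V where "open V" "convex V" "0 \<in> V" "V \<subseteq> U"
  using locally_convex[OF assms] unfolding convex_def by blast

typedef (overloaded) ('a::locally_convex_space) dual =
    "{f :: 'a \<Rightarrow> real. linear f \<and> continuous_on UNIV f}"
  morphisms dual_apply Dual
  by (rule exI[of _ "\<lambda>_. 0"]) (simp add: module_hom_zero)

setup_lifting type_definition_dual

instantiation dual :: (locally_convex_space) real_vector
begin

lift_definition zero_dual :: "'a dual" is "\<lambda>_. 0"
  by (simp add: module_hom_zero)

lift_definition plus_dual :: "'a dual \<Rightarrow> 'a dual \<Rightarrow> 'a dual" is "\<lambda>f g x. f x + g x"
  by (auto intro: linear_compose_add continuous_on_add)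

lift_definition uminus_dual :: "'a dual \<Rightarrow> 'a dual" is "\<lambda>f x. - f x"
  by (auto intro: linear_compose_neg continuous_on_minus)

lift_definition minus_dual :: "'a dual \<Rightarrow> 'a dual \<Rightarrow> 'a dual" is "\<lambda>f g x. f x - g x"
  by (auto intro: linear_compose_sub continuous_on_diff)

lift_definition scaleR_dual :: "real \<Rightarrow> 'a dual \<Rightarrow> 'a dual" is "\<lambda>r f x. r * f x"
  by (auto intro: linear_compose_scale_right[where 'b = real, simplified] continuous_on_mult_left)

instance
  by standard (transfer; simp add: algebra_simps)+

end

text \<open>The weak-star topology: the one induced by the topology of pointwise convergence, which is
  the topology the library puts on a function type.\<close>

instantiation dual :: (locally_convex_space) topological_space
begin

definition open_dual :: "'a dual set \<Rightarrow> bool" where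
  "open_dual U \<longleftrightarrow> (\<exists>V. open V \<and> U = dual_apply -` V)"

instance
proof
  show "open (UNIV :: 'a dual set)"
    unfolding open_dual_def by (rule exI[of _ UNIV]) simp
next
  fix S T :: "'a dual set"
  assume "open S" "open T"
  then obtain V W where "open V" "S = dual_apply -` V" "open W" "T = dual_apply -` W"
    unfolding open_dual_def by blast
  then show "open (S \<inter> T)"
    unfolding open_dual_def by (intro exI[of _ "V \<inter> W"]) auto
next
  fix K :: "'a dual set set"
  assume "\<forall>S\<in>K. open S"
  then obtain V where "\<And>S. S \<in> K \<Longrightarrow> open (V S) \<and> S = dual_apply -` V S"
    unfolding open_dual_def by metis
  then show "open (\<Union>K)"
    unfolding open_dual_def by (intro exI[of _ "\<Union>S\<in>K. V S"]) auto
qed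

end

definition coupling :: "'a::locally_convex_space \<times> 'a dual \<Rightarrow> real" where
  "coupling z = dual_apply (snd z) (fst z)"

definition zdot :: "'a::locally_convex_space \<times> 'a dual \<Rightarrow> 'a \<times> 'a dual \<Rightarrow> real" where
  "zdot z w = dual_apply (snd w) (fst z) + dual_apply (snd z) (fst w)"

definition monotone_operator :: "('a::locally_convex_space \<times> 'a dual) set \<Rightarrow> bool" where
  "monotone_operator T \<longleftrightarrow> (\<forall>z\<in>T. \<forall>w\<in>T. coupling (z - w) \<ge> 0)"

definition maximal_monotone :: "('a::locally_convex_space \<times> 'a dual) set \<Rightarrow> bool" where
  "maximal_monotone T \<longleftrightarrow> monotone_operator T \<and> \<not> (\<exists>S. monotone_operator S \<and> T \<subset> S)"

definition unique_operator :: "('a::locally_convex_space \<times> 'a dual) set \<Rightarrow> bool" where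
  "unique_operator T \<longleftrightarrow> monotone_operator T \<and> (\<exists>!M. maximal_monotone M \<and> T \<subseteq> M)"

definition proper_fun :: "('b \<Rightarrow> ereal) \<Rightarrow> bool" where
  "proper_fun f \<longleftrightarrow> (\<forall>z. f z \<noteq> -\<infinity>) \<and> (\<exists>z. f z \<noteq> \<infinity>)"

text \<open>Convexity of an extended-real-valued function is convexity of its epigraph; the library
  notion \<open>convex_on\<close> covers only real-valued functions.\<close>

definition convex_fun :: "('b::real_vector \<Rightarrow> ereal) \<Rightarrow> bool" where
  "convex_fun f \<longleftrightarrow> convex {(z, r::real). f z \<le> ereal r}"

definition lower_semicontinuous :: "('b::topological_space \<Rightarrow> ereal) \<Rightarrow> bool" where
  "lower_semicontinuous f \<longleftrightarrow> (\<forall>z. \<forall>a < f z. \<forall>\<^sub>F w in nhds z. a < f w)"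

definition square_conj ::
    "('a::locally_convex_space \<times> 'a dual \<Rightarrow> ereal) \<Rightarrow> 'a \<times> 'a dual \<Rightarrow> ereal" where
  "square_conj f z = (SUP w. ereal (zdot z w) - f w)"

text \<open>Lower semicontinuity below refers to the product of the given topology with the weak-star
  topology, which is the topology of the product type.\<close>

definition dual_representable :: "('a::locally_convex_space \<times> 'a dual) set \<Rightarrow> bool" where
  "dual_representable T \<longleftrightarrow>
    (\<exists>f. proper_fun f \<and> convex_fun f \<and> lower_semicontinuous f \<and>
         (\<forall>z. f z \<ge> ereal (coupling z)) \<and> (\<forall>z. square_conj f z \<ge> ereal (coupling z)) \<and>
         T = {z. f z = ereal (coupling z)})"

end

theory Submission
  imports Defs
begin

text \<open>A maximal monotone \<open>T\<close> is represented by its Fitzpatrick function \<open>\<phi>\<close>, the supremum over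
  \<open>t \<in> T\<close> of \<open>z \<cdot> t - c t\<close>. Conversely, let \<open>f\<close> represent the unique \<open>T\<close>. Its only maximal
  monotone extension is the set \<open>M\<close> of all points monotonically related to \<open>T\<close>. Both \<open>f\<close> and
  \<open>f\<^sup>\<box>\<close> dominate \<open>\<phi>\<close> and \<open>c\<close>, and monotonicity of \<open>M\<close> forces every such function to dominate the
  affine function \<open>w \<cdot> z - c z\<close> for each \<open>z \<in> M\<close>. By the Fenchel--Moreau theorem the bound on
  \<open>f\<^sup>\<box>\<close> gives \<open>f z \<le> c z\<close>, so \<open>M \<subseteq> T\<close>.\<close>

section \<open>The weak-star dual\<close>

lemma linear_dual_apply: "linear (dual_apply f)"
  using dual_apply[of f] by simp

lemma continuous_dual_apply: "continuous_on UNIV (dual_apply f)"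
  using dual_apply[of f] by simp

lemma dual_apply_simps:
  "dual_apply 0 x = 0"
  "dual_apply (f + g) x = dual_apply f x + dual_apply g x"
  "dual_apply (f - g) x = dual_apply f x - dual_apply g x"
  "dual_apply (- f) x = - dual_apply f x"
  "dual_apply (r *\<^sub>R f) x = r * dual_apply f x"
  by (transfer; simp)+

lemmas dual_apply_linear_simps =
  linear_add[OF linear_dual_apply] linear_diff[OF linear_dual_apply]
  linear_neg[OF linear_dual_apply] linear_scale[OF linear_dual_apply] linear_0[OF linear_dual_apply]

lemma open_dual_apply_vimage: "open S \<Longrightarrow> open ((\<lambda>f. dual_apply f x) -` S)"
  unfolding open_dual_def
  by (rule exI[of _ "(\<lambda>f. f x) -` S"]) (auto intro: open_vimage)

lemma continuous_on_dual_apply_left: "continuous_on UNIV (\<lambda>f. dual_apply f x)"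
  using open_dual_apply_vimage by (auto simp: continuous_on_open_vimage)

text \<open>A basic open set of the product topology restricts only finitely many coordinates. These
  form \<open>F\<close>, and finiteness allows one radius for all of them.\<close>

lemma weak_star_nbhd:
  assumes "open V" "f \<in> V"
  obtains F e where "finite F" "e > 0" "\<And>g. \<forall>x\<in>F. \<bar>dual_apply g x\<bar> < e \<Longrightarrow> f + g \<in> V"
proof -
  obtain W where W: "open W" "V = dual_apply -` W"
    using assms(1) unfolding open_dual_def by blast
  have "openin (product_topology (\<lambda>i. euclidean) UNIV) W" "dual_apply f \<in> W"
    using W assms(2) by (auto simp: open_fun_def)
  from product_topology_open_contains_basis[OF this]
  obtain X where X: "dual_apply f \<in> (\<Pi>\<^sub>E i\<in>UNIV. X i)" "\<And>i. open (X i)" "finite {i. X i \<noteq> UNIV}"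
    "(\<Pi>\<^sub>E i\<in>UNIV. X i) \<subseteq> W"
    by auto
  define F where "F = {i. X i \<noteq> UNIV}"
  have "\<exists>d>0. \<forall>r. \<bar>r\<bar> < d \<longrightarrow> dual_apply f i + r \<in> X i" for i
  proof -
    obtain d where "d > 0" "ball (dual_apply f i) d \<subseteq> X i"
      using X(1,2) open_contains_ball by (metis PiE_mem UNIV_I)
    then show ?thesis
      by (intro exI[of _ d]) (auto simp: subset_iff dist_real_def)
  qed
  then obtain d where d: "\<And>i. d i > 0" "\<And>i r. \<bar>r\<bar> < d i \<Longrightarrow> dual_apply f i + r \<in> X i"
    by metis
  \<comment> \<open>The inserted 1 keeps the minimum well defined and positive when \<open>F\<close>
    is empty.\<close>
  define e where "e = Min (insert 1 (d ` F))"
  have fin: "finite (insert 1 (d ` F))"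
    using X(3) by (simp add: F_def)
  show thesis
  proof
    show "finite F"
      using X(3) by (simp add: F_def)
    show "e > 0"
      using fin d(1) by (auto simp: e_def)
    fix g assume g: "\<forall>x\<in>F. \<bar>dual_apply g x\<bar> < e"
    have "dual_apply (f + g) i \<in> X i" for i
    proof (cases "i \<in> F")
      case True
      then have "e \<le> d i"
        using fin by (auto simp: e_def intro!: Min_le)
      then show ?thesis
        using g True d(2)[of "dual_apply g i" i] by (force simp: dual_apply_simps)
    qed (auto simp: F_def)
    then show "f + g \<in> V"
      using X(4) W(2) by auto
  qed
qed

section \<open>Scaling, absorption and continuous functionals\<close>

lemma tendsto_scaleR_locally_convex:
  fixes g :: "'b \<Rightarrow> 'a::locally_convex_space"
  assumes "(f \<longlongrightarrow> r) F" "(g \<longlongrightarrow> x) F"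
  shows "((\<lambda>t. f t *\<^sub>R g t) \<longlongrightarrow> r *\<^sub>R x) F"
  using filterlim_compose[OF tendsto_scaleR_Pair filterlim_Pair[OF assms]] by simp

lemma open_scaleR_vimage:
  fixes U :: "'a::locally_convex_space set"
  assumes "open U"
  shows "open ((\<lambda>x. r *\<^sub>R x) -` U)"
proof -
  have "continuous_on UNIV (\<lambda>x::'a. r *\<^sub>R x)"
    unfolding continuous_on_def
    by (intro ballI tendsto_scaleR_locally_convex tendsto_const tendsto_ident_at)
  then show ?thesis
    using assms by (auto simp: continuous_on_open_vimage)
qed

lemma nbhd_absorbs:
  fixes U :: "'a::locally_convex_space set"
  assumes "open U" "0 \<in> U"
  obtains r where "r > 0" "r *\<^sub>R x \<in> U"
proof -
  have "((\<lambda>t. t *\<^sub>R x) \<longlongrightarrow> 0 *\<^sub>R x) (at_right (0::real))"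
    by (intro tendsto_scaleR_locally_convex tendsto_const tendsto_ident_at)
  then have "\<forall>\<^sub>F t in at_right (0::real). t *\<^sub>R x \<in> U"
    using assms topological_tendstoD by fastforce
  moreover have "\<forall>\<^sub>F t in at_right (0::real). t > 0"
    by (simp add: eventually_at_right_less)
  ultimately have "\<forall>\<^sub>F t in at_right (0::real). t > 0 \<and> t *\<^sub>R x \<in> U"
    by eventually_elim simp
  then have "\<exists>t>0. t *\<^sub>R x \<in> U"
    by (rule eventually_happens'[OF trivial_limit_at_right_real])
  then show thesis
    using that by blast
qed

lemma continuous_of_bounded_on_nbhd:
  fixes l :: "'a::locally_convex_space \<Rightarrow> real"
  assumes "linear l" "open U" "0 \<in> U" and bound: "\<And>u. u \<in> U \<Longrightarrow> \<bar>l u\<bar> \<le> b"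
  shows "continuous_on UNIV l"
  unfolding continuous_on_def
proof (rule ballI, rule tendstoI)
  fix x and e :: real assume "e > 0"
  have "b \<ge> 0"
    using bound[OF assms(3)] by simp
  \<comment> \<open>On the copy of \<open>U\<close> shrunk by the factor \<open>r\<close> and moved
    to \<open>x\<close>, \<open>l\<close> differs from \<open>l x\<close> by at most
    \<open>b / r\<close>. The summand 1 makes \<open>r\<close> positive and \<open>b / r\<close>
    strictly smaller than \<open>e\<close>.\<close>
  define r where "r = (b + 1) / e"
  have "r > 0"
    using \<open>e > 0\<close> \<open>b \<ge> 0\<close> by (simp add: r_def)
  define W where "W = (\<lambda>y. y - x) -` ((\<lambda>y. r *\<^sub>R y) -` U)"
  have "open W"
    unfolding W_def
    by (intro open_vimage open_scaleR_vimage assms continuous_on_diff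
        continuous_on_id continuous_on_const)
  moreover have "x \<in> W"
    using assms(3) by (simp add: W_def)
  moreover have "dist (l y) (l x) < e" if "y \<in> W" for y
  proof -
    have "\<bar>l (r *\<^sub>R (y - x))\<bar> \<le> b"
      using that bound by (simp add: W_def)
    then have "r * \<bar>l y - l x\<bar> \<le> b"
      using \<open>r > 0\<close> by (simp add: linear_scale[OF assms(1)] linear_diff[OF assms(1)] abs_mult)
    also have "b < r * e"
      using \<open>e > 0\<close> by (simp add: r_def)
    finally show ?thesis
      using \<open>r > 0\<close> by (simp add: dist_real_def)
  qed
  ultimately show "\<forall>\<^sub>F y in at x within UNIV. dist (l y) (l x) < e"
    unfolding eventually_at_topological by (intro exI[of _ W]) simp
qed

text \<open>A functional vanishing on the common kernel of finitely many evaluations is a linear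
  combination of them. Since evaluation is linear in the point, the combination is again an
  evaluation; the induction splits off one point at a time.\<close>

lemma linear_combination_of_evaluations:
  fixes l :: "'a::locally_convex_space dual \<Rightarrow> real"
  assumes "finite F" "linear l" "\<And>f. \<forall>x\<in>F. dual_apply f x = 0 \<Longrightarrow> l f = 0"
  shows "\<exists>x. \<forall>f. l f = dual_apply f x"
  using assms
proof (induction F arbitrary: l rule: finite_induct)
  case empty
  then show ?case
    by (intro exI[of _ 0]) (simp add: dual_apply_linear_simps)
next
  case (insert y F)
  note lin = linear_add[OF insert.prems(1)] linear_diff[OF insert.prems(1)]
    linear_scale[OF insert.prems(1)]
  show ?case
  proof (cases "\<exists>g. (\<forall>x\<in>F. dual_apply g x = 0) \<and> dual_apply g y \<noteq> 0")
    case True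
    then obtain g where g: "\<And>x. x \<in> F \<Longrightarrow> dual_apply g x = 0" "dual_apply g y \<noteq> 0"
      by blast
    \<comment> \<open>Subtracting a multiple of \<open>g\<close> from a functional corrects its
      value at \<open>y\<close> without touching its values on \<open>F\<close>. Hence
      \<open>k\<close> is the coefficient of the evaluation at \<open>y\<close>, and the remainder
      \<open>m\<close> is controlled by \<open>F\<close> alone.\<close>
    define k where "k = l g / dual_apply g y"
    define m where "m f = l f - k * dual_apply f y" for f
    have "linear m"
      by (intro linearI) (simp_all add: m_def lin dual_apply_simps algebra_simps)
    moreover have "m f = 0" if "\<forall>x\<in>F. dual_apply f x = 0" for f
    proof -
      have "l (f - (dual_apply f y / dual_apply g y) *\<^sub>R g) = 0"
        by (rule insert.prems(2)) (use that g in \<open>auto simp: dual_apply_simps\<close>)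
      then show ?thesis
        by (simp add: m_def k_def lin)
    qed
    ultimately obtain x where x: "\<forall>f. m f = dual_apply f x"
      using insert.IH by blast
    have "l f = dual_apply f (x + k *\<^sub>R y)" for f
      using x[rule_format, of f] unfolding m_def
      by (simp add: linear_add[OF linear_dual_apply] linear_scale[OF linear_dual_apply])
    then show ?thesis
      by blast
  next
    case False
    then show ?thesis
      by (intro insert.IH insert.prems) auto
  qed
qed
text \<open>All multiples of an element of the common kernel satisfy the smallness condition, so
  \<open>l\<close> is bounded on a whole line and vanishes there.\<close>

lemma weak_star_functional_is_evaluation:
  fixes l :: "'a::locally_convex_space dual \<Rightarrow> real"
  assumes "finite F" "linear l" "e > 0"
    and bound: "\<And>f. \<forall>x\<in>F. \<bar>dual_apply f x\<bar> < e \<Longrightarrow> \<bar>l f\<bar> \<le> b"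
  shows "\<exists>x. \<forall>f. l f = dual_apply f x"
proof (rule linear_combination_of_evaluations[OF assms(1,2)])
  fix f assume f: "\<forall>x\<in>F. dual_apply f x = 0"
  show "l f = 0"
  proof (rule ccontr)
    assume "l f \<noteq> 0"
    have "\<bar>l (((\<bar>b\<bar> + 1) / l f) *\<^sub>R f)\<bar> \<le> b"
      using f \<open>e > 0\<close> by (intro bound) (simp add: dual_apply_simps)
    then show False
      using \<open>l f \<noteq> 0\<close> by (simp add: linear_scale[OF assms(2)])
  qed
qed

section \<open>Separation and conjugates\<close>

text \<open>Hahn--Banach: a maximal convex cone containing \<open>C\<close> but not \<open>(0, -1)\<close> is a half space.\<close>

lemma linear_minorant_of_convex_cone:
  fixes C :: "('a::real_vector \<times> real) set"
  assumes C: "convex_cone C" and total: "\<And>v. \<exists>r. (v, r) \<in> C"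
    and nonneg: "\<And>r. (0, r) \<in> C \<Longrightarrow> r \<ge> 0"
  obtains l where "linear l" "\<And>v r. (v, r) \<in> C \<Longrightarrow> l v \<le> r"
proof -
  define \<A> where "\<A> = {D. convex_cone D \<and> C \<subseteq> D \<and> (0, -1) \<notin> D}"
  have "C \<in> \<A>"
    using C nonneg[of "-1"] by (auto simp: \<A>_def)
  have "\<exists>M\<in>\<A>. \<forall>D\<in>\<A>. M \<subseteq> D \<longrightarrow> D = M"
  proof (rule subset_Zorn_nonempty)
    fix K assume K: "K \<noteq> {}" "subset.chain \<A> K"
    have *: "D \<in> K \<Longrightarrow> convex_cone D \<and> C \<subseteq> D \<and> (0, -1) \<notin> D" for D
      using K(2) by (auto simp: \<A>_def subset.chain_def)
    have "x + y \<in> \<Union>K" if "x \<in> D" "D \<in> K" "y \<in> E" "E \<in> K" for x y D E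
    proof -
      have "D \<subseteq> E \<or> E \<subseteq> D"
        using K(2) that by (auto simp: subset_chain_def)
      then show ?thesis
        using that *[of D] *[of E] convex_cone_add by blast
    qed
    moreover have "0 \<in> \<Union>K"
      using K(1) * convex_cone_contains_0 by blast
    moreover have "c *\<^sub>R x \<in> \<Union>K" if "x \<in> \<Union>K" "0 \<le> c" for x c
      using that * convex_cone_scaleR by blast
    ultimately have "convex_cone (\<Union>K)"
      by (auto simp: convex_cone_iff)
    then show "\<Union>K \<in> \<A>"
      using K(1) * by (auto simp: \<A>_def)
  qed (use \<open>C \<in> \<A>\<close> in blast)
  then obtain M where M: "convex_cone M" "C \<subseteq> M" "(0, -1) \<notin> M"
    and max: "\<And>D. convex_cone D \<Longrightarrow> (0, -1) \<notin> D \<Longrightarrow> M \<subseteq> D \<Longrightarrow> D = M"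
    unfolding \<A>_def by (smt (verit) mem_Collect_eq subset_trans)
  note add = convex_cone_add[OF M(1)] and scale = convex_cone_scaleR[OF M(1)]
    and zero = convex_cone_contains_0[OF M(1)]
  have M_nonneg: "r \<ge> 0" if "(0, r) \<in> M" for r
  proof (rule ccontr)
    assume "\<not> r \<ge> 0"
    then show False
      using scale[OF _ that, of "- 1 / r"] M(3) by (simp add: field_simps)
  qed
  \<comment> \<open>By maximality, adjoining the ray through \<open>x\<close> to \<open>M\<close>
    must bring in \<open>(0, -1)\<close>; the coefficient \<open>t\<close> is positive because
    \<open>M\<close> itself misses that point.\<close>
  have extend: "\<exists>c\<in>M. \<exists>t>0. c + t *\<^sub>R x = (0, -1)" if "x \<notin> M" for x
  proof (rule ccontr)
    assume neg: "\<not> ?thesis"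
    define D where "D = {c + t *\<^sub>R x |c t. c \<in> M \<and> t \<ge> 0}"
    have DI: "c + t *\<^sub>R x \<in> D" if "c \<in> M" "t \<ge> 0" for c t
      using that unfolding D_def by blast
    have "convex_cone D"
      unfolding convex_cone_iff
    proof (intro conjI ballI allI impI)
      show "0 \<in> D"
        using DI[OF zero, of 0] by simp
    next
      fix a b assume "a \<in> D" "b \<in> D"
      then obtain c t d s where "a = c + t *\<^sub>R x" "c \<in> M" "t \<ge> 0" "b = d + s *\<^sub>R x" "d \<in> M" "s \<ge> 0"
        by (auto simp: D_def)
      then show "a + b \<in> D"
        using DI[OF add, of c d "t + s"] by (simp add: algebra_simps)
    next
      fix a and k :: real assume "a \<in> D" "0 \<le> k"
      then obtain c t where "a = c + t *\<^sub>R x" "c \<in> M" "t \<ge> 0"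
        by (auto simp: D_def)
      then show "k *\<^sub>R a \<in> D"
        using DI[OF scale, of k c "k * t"] \<open>0 \<le> k\<close> by (simp add: algebra_simps)
    qed
    moreover have "(0, -1) \<notin> D"
    proof
      assume "(0, -1) \<in> D"
      then obtain c t where ct: "c + t *\<^sub>R x = (0, -1)" "c \<in> M" "t \<ge> 0"
        unfolding D_def by auto
      then have "t = 0"
        using neg by (cases "t = 0") force+
      then show False
        using ct M(3) by simp
    qed
    moreover have "M \<subseteq> D"
      using DI[of _ 0] by auto
    ultimately have "D = M"
      using max by blast
    moreover have "x \<in> D"
      using DI[OF zero, of 1] by simp
    ultimately show False
      using that by blast
  qed
  \<comment> \<open>Otherwise \<open>extend\<close> would put a point \<open>(0, - 1 - t)\<close> of
    negative height into \<open>M\<close>.\<close>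
  have up: "(0, 1) \<in> M"
  proof (rule ccontr)
    assume "(0, 1) \<notin> M"
    then obtain c t where "c \<in> M" "t > 0" "c + t *\<^sub>R (0, 1) = (0, -1 :: real)"
      using extend by blast
    then have "(0, - 1 - t) = c"
      by (cases c) auto
    then show False
      using M_nonneg[of "- 1 - t"] \<open>t > 0\<close> \<open>c \<in> M\<close> by simp
  qed
  have up': "(v, s) \<in> M" if "(v, r) \<in> M" "r \<le> s" for v r s
    using add[OF that(1) scale[OF _ up, of "s - r"]] that(2) by simp
  \<comment> \<open>This is the half space property: the relation from \<open>extend\<close> makes
    \<open>- x\<close> a positive multiple of \<open>c + (0, 1)\<close>.\<close>
  have dichotomy: "- x \<in> M" if x: "x \<notin> M" for x
  proof -
    obtain c t where ct: "c \<in> M" "t > 0" "c + t *\<^sub>R x = (0, -1)"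
      using extend[OF x] by blast
    have "(1 / t) *\<^sub>R (c + (0, 1)) \<in> M"
      using scale add ct up by simp
    moreover have "c + (0, 1) = - t *\<^sub>R x"
    proof -
      have "c = (0, -1) - t *\<^sub>R x"
        using ct(3) by (metis add_diff_cancel_right')
      then show ?thesis
        by (simp add: zero_prod_def)
    qed
    ultimately show ?thesis
      using ct(2) by simp
  qed
  \<comment> \<open>The value \<open>l v\<close> is the height at which the vertical line over
    \<open>v\<close> enters \<open>M\<close>. Membership on the boundary is not known, so the
    estimates below carry a margin.\<close>
  define l where "l v = Inf {r. (v, r) \<in> M}" for v
  have ne: "\<exists>r. (v, r) \<in> M" for v
    using total M(2) by blast
  have sum_nonneg: "r + s \<ge> 0" if "(v, r) \<in> M" "(- v, s) \<in> M" for v r s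
    using M_nonneg add[OF that] by simp
  have bdd: "bdd_below {r. (v, r) \<in> M}" for v
  proof -
    obtain s where "(- v, s) \<in> M"
      using ne by blast
    then show ?thesis
      using sum_nonneg by (force intro!: bdd_belowI[of _ "- s"])
  qed
  have l_le: "l v \<le> r" if "(v, r) \<in> M" for v r
    unfolding l_def using that bdd by (intro cInf_lower) auto
  have l_less: "(v, r) \<in> M" if "l v < r" for v r
    using that cInf_lessD[of "{r. (v, r) \<in> M}" r] ne up' unfolding l_def by fastforce
  \<comment> \<open>A point strictly below the graph lies outside \<open>M\<close>, so its negative
    lies in \<open>M\<close>; this makes \<open>l\<close> odd, and oddness turns sublinearity into
    linearity.\<close>
  have less_l: "(- v, - r) \<in> M" if "r < l v" for v r
    using dichotomy[of "(v, r)"] l_le that by fastforce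
  have neg: "l (- v) = - l v" for v
  proof (rule antisym)
    show "l (- v) \<le> - l v"
    proof (rule field_le_epsilon)
      fix e :: real assume "0 < e"
      then show "l (- v) \<le> - l v + e"
        using l_le[OF less_l[of "l v - e" v]] by simp
    qed
    show "- l v \<le> l (- v)"
    proof (rule field_le_epsilon)
      fix e :: real assume "0 < e"
      then show "- l v \<le> l (- v) + e"
        using sum_nonneg[OF l_less[of v "l v + e/2"] l_less[of "- v" "l (- v) + e/2"]] by simp
    qed
  qed
  have sub: "l (v + w) \<le> l v + l w" for v w
  proof (rule field_le_epsilon)
    fix e :: real assume "0 < e"
    then show "l (v + w) \<le> l v + l w + e"
      using l_le[of "v + w" "(l v + e/2) + (l w + e/2)"]
        add[OF l_less[of v "l v + e/2"] l_less[of w "l w + e/2"]] by simp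
  qed
  have additive: "l (v + w) = l v + l w" for v w
    using sub[of v w] sub[of "v + w" "- w"] neg[of w] by simp
  have pos_le: "l (k *\<^sub>R v) \<le> k * l v" if "k > 0" for k v
  proof (rule field_le_epsilon)
    fix e :: real assume "0 < e"
    then show "l (k *\<^sub>R v) \<le> k * l v + e"
      using l_le[of "k *\<^sub>R v" "k * (l v + e / k)"] scale[OF _ l_less[of v "l v + e / k"], of k] that
      by (simp add: algebra_simps)
  qed
  have pos: "l (k *\<^sub>R v) = k * l v" if "k > 0" for k v
    using pos_le[OF that, of v] pos_le[OF that, of "- v"] neg[of v] neg[of "k *\<^sub>R v"] by simp
  have "l 0 = 0"
    using additive[of 0 0] by simp
  have "l (k *\<^sub>R v) = k * l v" for k v
    using pos[of k v] pos[of "- k" v] neg[of "k *\<^sub>R v"] \<open>l 0 = 0\<close>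
    by (cases k "0::real" rule: linorder_cases) auto
  then have "linear l"
    by (intro linearI) (auto simp: additive)
  then show thesis
    using that l_le M(2) by blast
qed

text \<open>The cone generated by the epigraph, lowered by \<open>e\<close>, and by \<open>N \<times> {e}\<close> satisfies the hypotheses of
  \<open>linear_minorant_of_convex_cone\<close>.\<close>

lemma affine_minorant_of_convex_epigraph:
  fixes E :: "('a::real_vector \<times> real) set"
  assumes "convex E" "E \<noteq> {}" "convex N" "0 \<in> N" "e > 0"
    and sym: "\<And>n. n \<in> N \<Longrightarrow> - n \<in> N"
    and absorb: "\<And>v. \<exists>r>0. r *\<^sub>R v \<in> N"
    and nonneg: "\<And>w a. (w, a) \<in> E \<Longrightarrow> a \<ge> 0"
    and ge: "\<And>w a. (w, a) \<in> E \<Longrightarrow> w \<in> N \<Longrightarrow> a \<ge> e"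
  obtains l where "linear l" "\<And>w a. (w, a) \<in> E \<Longrightarrow> l w + e \<le> a" "\<And>n. n \<in> N \<Longrightarrow> l n \<le> e"
proof -
  define A where "A = (+) (0, - e) ` E"
  define B where "B = N \<times> {e}"
  define C where "C = (\<Union>x\<in>conic hull A. \<Union>y\<in>conic hull B. {x + y})"
  have "convex A" "convex B"
    using assms by (simp_all add: A_def B_def convex_translation convex_Times)
  have CI: "(t *\<^sub>R w + s *\<^sub>R n, t * (a - e) + s * e) \<in> C"
    if "(w, a) \<in> E" "n \<in> N" "t \<ge> 0" "s \<ge> 0" for w a n t s
  proof -
    have "t *\<^sub>R (w, a - e) \<in> conic hull A"
      using that unfolding conic_hull_explicit A_def by (force simp: image_iff)
    moreover have "s *\<^sub>R (n, e) \<in> conic hull B"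
      using that unfolding conic_hull_explicit B_def by blast
    ultimately show ?thesis
      unfolding C_def by force
  qed
  have CE: "\<exists>w a n t s. (w, a) \<in> E \<and> n \<in> N \<and> t \<ge> 0 \<and> s \<ge> 0 \<and>
      v = t *\<^sub>R w + s *\<^sub>R n \<and> r = t * (a - e) + s * e" if vr: "(v, r) \<in> C" for v r
  proof -
    obtain p q where pq: "p \<in> conic hull A" "q \<in> conic hull B" "(v, r) = p + q"
      using vr unfolding C_def by blast
    obtain t x where tx: "p = t *\<^sub>R x" "t \<ge> 0" "x \<in> A"
      using pq(1) unfolding conic_hull_explicit by blast
    obtain s y where sy: "q = s *\<^sub>R y" "s \<ge> 0" "y \<in> B"
      using pq(2) unfolding conic_hull_explicit by blast
    obtain w a where "x = (w, a - e)" "(w, a) \<in> E"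
      using tx(3) by (auto simp: A_def)
    moreover obtain n where "y = (n, e)" "n \<in> N"
      using sy(3) by (auto simp: B_def)
    ultimately show ?thesis
      using pq tx sy by (intro exI[of _ w] exI[of _ a] exI[of _ n] exI[of _ t] exI[of _ s]) simp
  qed
  obtain w0 a0 where "(w0, a0) \<in> E"
    using assms(2) by auto
  obtain l where l: "linear l" "\<And>v r. (v, r) \<in> C \<Longrightarrow> l v \<le> r"
  proof (rule linear_minorant_of_convex_cone[of C])
    show "convex_cone C"
      unfolding convex_cone_def
    proof (intro conjI)
      show "C \<noteq> {}"
        using CI[OF \<open>(w0, a0) \<in> E\<close> assms(4), of 0 0] by auto
      show "convex C"
        unfolding C_def by (intro convex_sums convex_conic_hull \<open>convex A\<close> \<open>convex B\<close>)
      show "conic C"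
        unfolding C_def by (intro conic_sums conic_conic_hull)
    qed
  next
    fix v
    obtain r where "r > 0" "r *\<^sub>R v \<in> N"
      using absorb by blast
    then show "\<exists>r. (v, r) \<in> C"
      using CI[OF \<open>(w0, a0) \<in> E\<close>, of "r *\<^sub>R v" 0 "1 / r"] by auto
  next
    fix r assume "(0, r) \<in> C"
    then obtain w a n t s where *: "(w, a) \<in> E" "n \<in> N" "t \<ge> 0" "s \<ge> 0"
      "t *\<^sub>R w + s *\<^sub>R n = 0" "r = t * (a - e) + s * e"
      using CE by metis
    \<comment> \<open>If \<open>s < t\<close>, then \<open>w\<close> is the multiple
      \<open>s / t\<close> of \<open>- n\<close> and so lies in \<open>N\<close>, where
      \<open>a\<close> is at least \<open>e\<close>. Otherwise \<open>s * e\<close> pays for the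
      lowering \<open>t * e\<close>, and \<open>a \<ge> 0\<close> suffices.\<close>
    show "r \<ge> 0"
    proof (cases "s < t")
      case True
      have "t *\<^sub>R w = s *\<^sub>R (- n)"
        using *(5) by (simp add: eq_neg_iff_add_eq_0)
      then have "(1 / t) *\<^sub>R (t *\<^sub>R w) = (1 / t) *\<^sub>R (s *\<^sub>R (- n))"
        by simp
      then have "w = (1 - s / t) *\<^sub>R 0 + (s / t) *\<^sub>R (- n)"
        using True *(4) by simp
      also have "\<dots> \<in> N"
        using True *(4) sym[OF *(2)] assms(3,4) by (intro convexD_alt) auto
      finally have "a \<ge> e"
        using ge *(1) by blast
      then show ?thesis
        using * \<open>e > 0\<close> by simp
    next
      case False
      have "0 \<le> t * a + (s - t) * e"
        using False * nonneg \<open>e > 0\<close> by (intro add_nonneg_nonneg mult_nonneg_nonneg) auto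
      then show ?thesis
        using *(6) by (simp add: algebra_simps)
    qed
  qed blast
  show thesis
  proof
    show "linear l"
      by fact
    show "l w + e \<le> a" if "(w, a) \<in> E" for w a
      using l(2)[OF CI[OF that assms(4), of 1 0]] by simp
    show "l n \<le> e" if "n \<in> N" for n
      using l(2)[OF CI[OF \<open>(w0, a0) \<in> E\<close> that, of 0 1]] by simp
  qed
qed

section \<open>The pairing, its quadratic form and duality\<close>

lemma zdot_commute: "zdot z w = zdot w z"
  by (simp add: zdot_def)

lemma linear_zdot: "linear (\<lambda>z. zdot z w)"
  by (intro linearI) (simp_all add: zdot_def dual_apply_simps dual_apply_linear_simps algebra_simps)

lemma zdot_simps:
  "zdot (z + z') w = zdot z w + zdot z' w" "zdot w (z + z') = zdot w z + zdot w z'"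
  "zdot (z - z') w = zdot z w - zdot z' w" "zdot w (z - z') = zdot w z - zdot w z'"
  "zdot (r *\<^sub>R z) w = r * zdot z w" "zdot w (r *\<^sub>R z) = r * zdot w z"
  using linear_add[OF linear_zdot] linear_diff[OF linear_zdot] linear_scale[OF linear_zdot]
  by (simp_all add: zdot_commute[of w])

lemma coupling_simps:
  "coupling (z + w) = coupling z + zdot z w + coupling w"
  "coupling (z - w) = coupling z - zdot z w + coupling w"
  "coupling (r *\<^sub>R z) = r\<^sup>2 * coupling z"
  "zdot z z = 2 * coupling z"
  by (simp_all add: zdot_def coupling_def dual_apply_simps dual_apply_linear_simps algebra_simps
      power2_eq_square)

lemma continuous_on_zdot: "continuous_on UNIV (\<lambda>z. zdot z w)"
proof -
  have "continuous_on UNIV (\<lambda>z. dual_apply (snd w) (fst z))"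
    by (rule continuous_on_compose2[OF continuous_dual_apply continuous_on_fst]) auto
  moreover have "continuous_on UNIV (\<lambda>z. dual_apply (snd z) (fst w))"
    by (rule continuous_on_compose2[OF continuous_on_dual_apply_left continuous_on_snd]) auto
  ultimately show ?thesis
    unfolding zdot_def by (rule continuous_on_add)
qed

text \<open>The functional splits into its restrictions to the two factors. The first is bounded
  near 0, hence an element of the dual; the second is bounded on a weak-star neighbourhood, hence
  evaluation at a point.\<close>

lemma functional_is_zdot:
  fixes l :: "'a::locally_convex_space \<times> 'a dual \<Rightarrow> real"
  assumes "linear l" "open U" "0 \<in> U" "finite F" "d > 0"
    and bound: "\<And>u g. u \<in> U \<Longrightarrow> \<forall>x\<in>F. \<bar>dual_apply g x\<bar> < d \<Longrightarrow> \<bar>l (u, g)\<bar> \<le> b"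
  obtains y where "\<And>z. l z = zdot z y"
proof -
  define l1 where "l1 u = l (u, 0)" for u
  define l2 where "l2 g = l (0, g)" for g
  have lin: "linear l1" "linear l2"
    unfolding l1_def l2_def
    by (rule linear_compose[OF _ assms(1), unfolded o_def], rule linearI; simp)+
  have "continuous_on UNIV l1"
    using lin(1) assms(2,3)
    by (rule continuous_of_bounded_on_nbhd[where b = b])
      (use bound[of _ 0] \<open>d > 0\<close> in \<open>auto simp: l1_def dual_apply_simps\<close>)
  then have l1: "dual_apply (Dual l1) = l1"
    using lin(1) by (simp add: Dual_inverse)
  obtain x where x: "\<And>g. l2 g = dual_apply g x"
    using weak_star_functional_is_evaluation[OF assms(4) lin(2) \<open>d > 0\<close>, of b] bound[OF assms(3)]
    unfolding l2_def by blast
  show thesis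
  proof
    fix z
    show "l z = zdot z (x, Dual l1)"
      using linear_add[OF assms(1), of "(fst z, 0)" "(0, snd z)"]
      by (simp add: zdot_def l1 x[symmetric]) (simp add: l1_def l2_def)
  qed
qed

text \<open>The hypothesis \<open>conj\<close> bounds the biconjugate of \<open>f\<close> at
  \<open>z\<close> by \<open>d\<close>. Subtracting the given affine minorant makes \<open>f\<close>
  nonnegative, which lets the separation produce a non-vertical hyperplane directly: if
  \<open>f z\<close> exceeded \<open>d\<close>, so would some affine minorant at
  \<open>z\<close>.\<close>

lemma fenchel_moreau_bound:
  fixes f :: "'a::locally_convex_space \<times> 'a dual \<Rightarrow> ereal"
  assumes "convex_fun f" "lower_semicontinuous f" and dom: "\<exists>z. f z \<noteq> \<infinity>"
    and minorant: "\<And>w. ereal (zdot w u - c) \<le> f w"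
    and conj: "\<And>w. ereal (zdot w z - d) \<le> square_conj f w"
  shows "f z \<le> ereal d"
proof (rule ccontr)
  assume "\<not> f z \<le> ereal d"
  then obtain a where a: "d < a" "ereal a < f z"
    using ereal_dense2[of "ereal d" "f z"] by (auto simp: not_le)
  define \<delta> where "\<delta> = (a - d) / 2"
  have "\<delta> > 0"
    using a by (simp add: \<delta>_def)
  \<comment> \<open>Near \<open>z\<close> the difference of \<open>f\<close> and its minorant
    exceeds \<open>e\<close>: one half of the gap \<open>a - d\<close> absorbs the variation of the
    minorant, the other half is kept. Positivity of \<open>e\<close> comes from \<open>conj\<close>
    at \<open>u\<close>.\<close>
  define e where "e = d - zdot z u + c + \<delta>"
  have "square_conj f u \<le> ereal c"
    unfolding square_conj_def
  proof (rule SUP_least)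
    fix w
    show "ereal (zdot u w) - f w \<le> ereal c"
      using minorant[of w] by (cases "f w") (auto simp: zdot_commute)
  qed
  then have "zdot z u - d \<le> c"
    using conj[of u] by (metis ereal_less_eq(3) order_trans zdot_commute)
  then have "e > 0"
    using \<open>\<delta> > 0\<close> by (simp add: e_def)
  have "\<forall>\<^sub>F w in nhds z. ereal a < f w"
    using assms(2) a unfolding lower_semicontinuous_def by blast
  moreover have "\<forall>\<^sub>F w in nhds z. zdot w u < zdot z u + \<delta>"
  proof -
    have "open ((\<lambda>w. zdot w u) -` {..<zdot z u + \<delta>})"
      by (intro open_vimage continuous_on_zdot) auto
    then show ?thesis
      using eventually_nhds_in_open[of "(\<lambda>w. zdot w u) -` {..<zdot z u + \<delta>}" z] \<open>\<delta> > 0\<close>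
      by simp
  qed
  ultimately have "\<forall>\<^sub>F w in nhds z. ereal a < f w \<and> zdot w u < zdot z u + \<delta>"
    by eventually_elim simp
  then obtain S where S: "open S" "z \<in> S" "\<And>w. w \<in> S \<Longrightarrow> ereal a < f w \<and> zdot w u < zdot z u + \<delta>"
    unfolding eventually_nhds by blast
  obtain P Q where PQ: "open P" "open Q" "z \<in> P \<times> Q" "P \<times> Q \<subseteq> S"
    using open_prod_elim[OF S(1,2)] by blast
  have "open ((\<lambda>x. fst z + x) -` P)" "0 \<in> (\<lambda>x. fst z + x) -` P"
    using PQ by (auto intro!: open_vimage continuous_on_add continuous_on_const continuous_on_id)
  then obtain V where V: "open V" "convex V" "0 \<in> V" "V \<subseteq> (\<lambda>x. fst z + x) -` P"
    by (rule locally_convex_nbhd)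
  obtain F r where F: "finite F" "r > 0"
    "\<And>g. \<forall>x\<in>F. \<bar>dual_apply g x\<bar> < r \<Longrightarrow> snd z + g \<in> Q"
    using weak_star_nbhd[OF PQ(2), of "snd z"] PQ(3) by (metis mem_Times_iff)
  \<comment> \<open>Symmetrizing \<open>V\<close> provides the symmetric neighbourhood that the cone
    argument requires, and later turns the one-sided bound on \<open>l\<close> into a two-sided
    one.\<close>
  define U where "U = V \<inter> uminus -` V"
  define G where "G = {g. \<forall>x\<in>F. \<bar>dual_apply g x\<bar> < r}"
  have U: "open U" "convex U" "0 \<in> U" "\<And>x. x \<in> U \<Longrightarrow> - x \<in> U"
  proof -
    show "open U"
      unfolding U_def by (intro open_Int V open_vimage continuous_on_minus continuous_on_id)
    show "convex U"
      unfolding U_def by (intro convex_Int V convex_linear_vimage) (simp add: linear_uminus)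
  qed (use V(3) in \<open>auto simp: U_def\<close>)
  have "convex G"
  proof (rule convexI)
    fix g h and s t :: real
    assume gh: "g \<in> G" "h \<in> G" and st: "0 \<le> s" "0 \<le> t" "s + t = 1"
    have "\<bar>s * dual_apply g x + t * dual_apply h x\<bar> < r" if "x \<in> F" for x
    proof -
      have "convex {- r<..<r}"
        by simp
      then show ?thesis
        using convexD[of "{- r<..<r}" "dual_apply g x" "dual_apply h x" s t] gh st that
        by (force simp: G_def abs_less_iff)
    qed
    then show "s *\<^sub>R g + t *\<^sub>R h \<in> G"
      by (simp add: G_def dual_apply_simps)
  qed
  \<comment> \<open>All small multiples are covered, not just one, so that a common scale with
    \<open>U\<close> can be chosen.\<close>
  have absorb_G: "\<exists>t>0. \<forall>s. 0 < s \<and> s \<le> t \<longrightarrow> s *\<^sub>R g \<in> G" for g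
  proof -
    define M where "M = (\<Sum>x\<in>F. \<bar>dual_apply g x\<bar>) + 1"
    have M: "M > 0" "\<And>x. x \<in> F \<Longrightarrow> \<bar>dual_apply g x\<bar> < M"
      using member_le_sum[OF _ _ F(1), of _ "\<lambda>x. \<bar>dual_apply g x\<bar>"]
      by (fastforce simp: M_def intro: add_nonneg_pos sum_nonneg)+
    have "s *\<^sub>R g \<in> G" if "0 < s" "s \<le> r / M" for s
    proof -
      have "s * \<bar>dual_apply g x\<bar> < r" if "x \<in> F" for x
      proof -
        have "s * \<bar>dual_apply g x\<bar> < s * M"
          using M(2)[OF that] \<open>0 < s\<close> by simp
        also have "s * M \<le> r"
          using \<open>s \<le> r / M\<close> M(1) by (simp add: field_simps)
        finally show ?thesis .
      qed
      then show ?thesis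
        using \<open>0 < s\<close> by (simp add: G_def dual_apply_simps abs_mult)
    qed
    then show ?thesis
      using M(1) F(2) by (intro exI[of _ "r / M"]) simp
  qed
  \<comment> \<open>This is the epigraph of \<open>f\<close> minus its minorant, with
    \<open>z\<close> moved to the origin.\<close>
  define E where "E = {(v, b). f (z + v) \<le> ereal (b + zdot (z + v) u - c)}"
  have EI: "(w - z, b) \<in> E" if "f w = ereal (b + zdot w u - c)" for w b
    using that by (simp add: E_def)
  obtain l where l: "linear l" "\<And>w b. (w, b) \<in> E \<Longrightarrow> l w + e \<le> b" "\<And>n. n \<in> U \<times> G \<Longrightarrow> l n \<le> e"
  proof (rule affine_minorant_of_convex_epigraph[of E "U \<times> G" e])
    show "convex E"
    proof (rule convexI)
      fix p q and s t :: real
      assume pq: "p \<in> E" "q \<in> E" and st: "0 \<le> s" "0 \<le> t" "s + t = 1"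
      obtain v b w k where eq: "p = (v, b)" "q = (w, k)"
        by (meson surj_pair)
      have "s *\<^sub>R (z + v, b + zdot (z + v) u - c) + t *\<^sub>R (z + w, k + zdot (z + w) u - c)
          \<in> {(z, r::real). f z \<le> ereal r}"
        using assms(1) pq st unfolding convex_fun_def by (intro convexD) (auto simp: eq E_def)
      moreover have "s *\<^sub>R (z + v) + t *\<^sub>R (z + w) = z + (s *\<^sub>R v + t *\<^sub>R w)"
        using st(3) by (simp add: algebra_simps flip: scaleR_left.add)
      moreover have "s * (b + zdot (z + v) u - c) + t * (k + zdot (z + w) u - c)
          = s * b + t * k + zdot (z + (s *\<^sub>R v + t *\<^sub>R w)) u - c"
      proof -
        have t: "t = 1 - s"
          using st(3) by simp
        show ?thesis
          unfolding t by (simp add: zdot_simps algebra_simps)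
      qed
      ultimately show "s *\<^sub>R p + t *\<^sub>R q \<in> E"
        by (simp add: eq E_def)
    qed
    obtain w where "f w \<noteq> \<infinity>"
      using dom by blast
    then obtain k where "f w = ereal k"
      using minorant[of w] by (cases "f w") auto
    then show "E \<noteq> {}"
      using EI[of w "k - zdot w u + c"] by auto
    show "convex (U \<times> G)"
      by (intro convex_Times U \<open>convex G\<close>)
    show "0 \<in> U \<times> G"
      using U(3) F(2) by (simp add: zero_prod_def G_def dual_apply_simps)
    show "- n \<in> U \<times> G" if "n \<in> U \<times> G" for n
      using that U(4) by (auto simp: G_def dual_apply_simps)
    show "\<exists>r>0. r *\<^sub>R v \<in> U \<times> G" for v
    proof -
      obtain s where s: "s > 0" "s *\<^sub>R fst v \<in> U"
        using nbhd_absorbs[OF U(1,3)] by blast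
      obtain t where t: "t > 0" "\<And>s. 0 < s \<Longrightarrow> s \<le> t \<Longrightarrow> s *\<^sub>R snd v \<in> G"
        using absorb_G by blast
      define m where "m = min s t"
      have "(1 - m / s) *\<^sub>R 0 + (m / s) *\<^sub>R (s *\<^sub>R fst v) \<in> U"
        using s t(1) by (intro convexD_alt U) (auto simp: m_def)
      then show ?thesis
        using s t by (intro exI[of _ m]) (simp add: m_def mem_Times_iff)
    qed
    show "b \<ge> 0" if "(w, b) \<in> E" for w b
    proof -
      have "f (z + w) \<le> ereal (b + zdot (z + w) u - c)"
        using that by (simp add: E_def)
      with minorant[of "z + w"] have "ereal (zdot (z + w) u - c) \<le> ereal (b + zdot (z + w) u - c)"
        by (rule order_trans)
      then show ?thesis
        by simp
    qed
    show "b \<ge> e" if "(w, b) \<in> E" "w \<in> U \<times> G" for w b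
    proof -
      have "z + w \<in> P \<times> Q"
        using that(2) V(4) F(3) by (auto simp: U_def G_def mem_Times_iff)
      then have *: "ereal a < f (z + w)" "zdot (z + w) u < zdot z u + \<delta>"
        using S(3)[of "z + w"] PQ(4) by auto
      have "f (z + w) \<le> ereal (b + zdot (z + w) u - c)"
        using that(1) by (simp add: E_def)
      with *(1) have "ereal a < ereal (b + zdot (z + w) u - c)"
        by (rule order_less_le_trans)
      then show ?thesis
        using *(2) by (simp add: e_def \<delta>_def field_simps)
    qed
    show "e > 0"
      by fact
  qed blast
  obtain y where y: "\<And>z. l z = zdot z y"
  proof (rule functional_is_zdot[OF l(1) U(1,3) F(1,2), of e])
    fix v g assume "v \<in> U" "\<forall>x\<in>F. \<bar>dual_apply g x\<bar> < r"
    then have "(v, g) \<in> U \<times> G" "- (v, g) \<in> U \<times> G"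
      using U(4) by (auto simp: G_def dual_apply_simps)
    then show "\<bar>l (v, g)\<bar> \<le> e"
      using l(3)[of "(v, g)"] l(3)[of "- (v, g)"] linear_neg[OF l(1), of "(v, g)"] by simp
  qed blast
  \<comment> \<open>The separation yields an affine minorant of \<open>f\<close> with slope
    \<open>u + y\<close> and value \<open>d + \<delta>\<close> at \<open>z\<close>. In terms of the
    conjugate this contradicts \<open>conj\<close> at \<open>u + y\<close>.\<close>
  have "square_conj f (u + y) \<le> ereal (c + zdot z y - e)"
    unfolding square_conj_def
  proof (rule SUP_least)
    fix w
    show "ereal (zdot (u + y) w) - f w \<le> ereal (c + zdot z y - e)"
    proof (cases "f w")
      case (real k)
      have "zdot (w - z) y + e \<le> k - zdot w u + c"
        using l(2)[OF EI[of w "k - zdot w u + c"]] real by (simp add: y)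
      then show ?thesis
        using real by (simp add: zdot_simps zdot_commute)
    qed (use minorant[of w] in auto)
  qed
  with conj[of "u + y"] have "zdot (u + y) z - d \<le> c + zdot z y - e"
    by (metis ereal_less_eq(3) order_trans)
  then show False
    using \<open>\<delta> > 0\<close> by (simp add: e_def zdot_simps zdot_commute)
qed

section \<open>Monotone operators and Fitzpatrick functions\<close>

text \<open>Zorn's lemma applies because any two points of the union of a chain lie in a common
  member.\<close>

lemma monotone_operator_extension:
  assumes "monotone_operator T"
  obtains M where "maximal_monotone M" "T \<subseteq> M"
proof -
  define \<A> where "\<A> = {S. monotone_operator S \<and> T \<subseteq> S}"
  have "\<exists>M\<in>\<A>. \<forall>S\<in>\<A>. M \<subseteq> S \<longrightarrow> S = M"
  proof (rule subset_Zorn_nonempty)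
    show "\<A> \<noteq> {}"
      using assms by (auto simp: \<A>_def)
  next
    fix K assume K: "K \<noteq> {}" "subset.chain \<A> K"
    have *: "monotone_operator S \<and> T \<subseteq> S" if "S \<in> K" for S
      using K(2) that by (auto simp: \<A>_def subset_chain_def)
    have "coupling (z - w) \<ge> 0" if "z \<in> S" "S \<in> K" "w \<in> R" "R \<in> K" for z w S R
    proof -
      have "S \<subseteq> R \<or> R \<subseteq> S"
        using K(2) that by (auto simp: subset_chain_def)
      then show ?thesis
        using that *[of S] *[of R] unfolding monotone_operator_def by blast
    qed
    then have "monotone_operator (\<Union>K)"
      unfolding monotone_operator_def by blast
    moreover have "T \<subseteq> \<Union>K"
      using K(1) * by blast
    ultimately show "\<Union>K \<in> \<A>"
      by (simp add: \<A>_def)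
  qed
  then obtain M where "M \<in> \<A>" and max: "\<And>S. S \<in> \<A> \<Longrightarrow> M \<subseteq> S \<Longrightarrow> S = M"
    by blast
  then have "maximal_monotone M"
    unfolding maximal_monotone_def \<A>_def by blast
  then show thesis
    using that \<open>M \<in> \<A>\<close> by (auto simp: \<A>_def)
qed

lemma coupling_minus_swap: "coupling (z - w) = coupling (w - z)"
  by (simp add: coupling_simps zdot_commute)

lemma monotone_operator_insert:
  assumes "monotone_operator T" "\<And>t. t \<in> T \<Longrightarrow> coupling (z - t) \<ge> 0"
  shows "monotone_operator (insert z T)"
  using assms coupling_minus_swap[of _ z]
  by (simp add: monotone_operator_def) (simp add: coupling_def dual_apply_simps)

lemma maximal_monotone_mem:
  assumes "maximal_monotone T" "\<And>t. t \<in> T \<Longrightarrow> coupling (z - t) \<ge> 0"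
  shows "z \<in> T"
  using monotone_operator_insert[of T z] assms unfolding maximal_monotone_def by blast

text \<open>Adjoining to \<open>T\<close> a single point monotonically related to it keeps it
  monotone. A maximal extension of the enlarged set also extends \<open>T\<close>, so it is
  \<open>M\<close>.\<close>

lemma unique_operator_extension_eq:
  assumes "unique_operator T" "maximal_monotone M" "T \<subseteq> M"
  shows "M = {z. \<forall>t\<in>T. coupling (z - t) \<ge> 0}"
proof
  show "M \<subseteq> {z. \<forall>t\<in>T. coupling (z - t) \<ge> 0}"
    using assms(2,3) by (auto simp: maximal_monotone_def monotone_operator_def)
  show "{z. \<forall>t\<in>T. coupling (z - t) \<ge> 0} \<subseteq> M"
  proof
    fix z assume "z \<in> {z. \<forall>t\<in>T. coupling (z - t) \<ge> 0}"
    then have "monotone_operator (insert z T)"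
      using assms(1) by (intro monotone_operator_insert) (auto simp: unique_operator_def)
    then obtain N where "maximal_monotone N" "insert z T \<subseteq> N"
      by (rule monotone_operator_extension)
    then show "z \<in> M"
      using assms unfolding unique_operator_def by blast
  qed
qed

text \<open>This is the conjugate of the function equal to \<open>coupling\<close> on
  \<open>T\<close> and to infinity elsewhere.\<close>

definition fitzpatrick :: "('a::locally_convex_space \<times> 'a dual) set \<Rightarrow> 'a \<times> 'a dual \<Rightarrow> ereal" where
  "fitzpatrick T z = (SUP t\<in>T. ereal (zdot z t - coupling t))"

lemma fitzpatrick_le_iff:
  "fitzpatrick T z \<le> ereal r \<longleftrightarrow> (\<forall>t\<in>T. zdot z t - coupling t \<le> r)"
  by (simp add: fitzpatrick_def SUP_le_iff)

text \<open>Expanding \<open>coupling (z - t)\<close> gives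
  \<open>coupling z - (zdot z t - coupling t)\<close>.\<close>

lemma fitzpatrick_le_coupling_iff:
  "fitzpatrick T z \<le> ereal (coupling z) \<longleftrightarrow> (\<forall>t\<in>T. coupling (z - t) \<ge> 0)"
  unfolding fitzpatrick_le_iff by (rule ball_cong) (auto simp: coupling_simps)

lemma convex_fun_fitzpatrick: "convex_fun (fitzpatrick T)"
  unfolding convex_fun_def
proof (rule convexI)
  fix p q and s t :: real
  assume pq: "p \<in> {(z, r). fitzpatrick T z \<le> ereal r}" "q \<in> {(z, r). fitzpatrick T z \<le> ereal r}"
    and st: "0 \<le> s" "0 \<le> t" "s + t = 1"
  obtain z r w k where eq: "p = (z, r)" "q = (w, k)"
    by (meson surj_pair)
  have "s * zdot z y + t * zdot w y - coupling y \<le> s * r + t * k" if "y \<in> T" for y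
  proof -
    have "s * (zdot z y - coupling y) + t * (zdot w y - coupling y) \<le> s * r + t * k"
      using pq st that by (intro add_mono mult_left_mono) (auto simp: eq fitzpatrick_le_iff)
    moreover have "s * coupling y + t * coupling y = coupling y"
      using st(3) by (simp flip: distrib_right)
    ultimately show ?thesis
      by (simp add: right_diff_distrib)
  qed
  then show "s *\<^sub>R p + t *\<^sub>R q \<in> {(z, r). fitzpatrick T z \<le> ereal r}"
    by (simp add: eq fitzpatrick_le_iff zdot_simps)
qed

lemma lower_semicontinuous_fitzpatrick: "lower_semicontinuous (fitzpatrick T)"
  unfolding lower_semicontinuous_def
proof (intro allI impI)
  fix z a assume "a < fitzpatrick T z"
  then obtain t where t: "t \<in> T" "a < ereal (zdot z t - coupling t)"
    unfolding fitzpatrick_def less_SUP_iff by blast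
  define S where "S = (\<lambda>w. ereal (zdot w t - coupling t)) -` {a<..}"
  have "continuous_on UNIV (\<lambda>w. ereal (zdot w t - coupling t))"
    by (intro continuous_on_ereal continuous_on_diff continuous_on_zdot continuous_on_const)
  then have "open S"
    unfolding S_def by (intro open_vimage) auto
  moreover have "a < fitzpatrick T w" if "w \<in> S" for w
    using that t(1) unfolding S_def fitzpatrick_def less_SUP_iff by auto
  ultimately show "\<forall>\<^sub>F w in nhds z. a < fitzpatrick T w"
    using t(2) unfolding eventually_nhds by (intro exI[of _ S]) (simp add: S_def)
qed

text \<open>A point where the Fitzpatrick function is at most \<open>coupling\<close> is
  monotonically related to \<open>T\<close>, hence in \<open>T\<close> by maximality. On
  \<open>T\<close> the term \<open>t = z\<close> of the supremum gives the lower bound and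
  monotonicity the upper one.\<close>

lemma fitzpatrick_of_maximal_monotone:
  assumes "maximal_monotone T"
  shows "ereal (coupling z) \<le> fitzpatrick T z"
    and "fitzpatrick T z = ereal (coupling z) \<longleftrightarrow> z \<in> T"
proof -
  have le: "z \<in> T" if "fitzpatrick T z \<le> ereal (coupling z)" for z
    using that by (intro maximal_monotone_mem[OF assms]) (simp_all add: fitzpatrick_le_coupling_iff)
  have ge: "ereal (coupling z) \<le> fitzpatrick T z" if "z \<in> T" for z
    using that unfolding fitzpatrick_def by (intro SUP_upper2[of z]) (auto simp: coupling_simps)
  have eq: "fitzpatrick T z = ereal (coupling z)" if "z \<in> T" for z
  proof (rule antisym[OF _ ge[OF that]])
    have "coupling (z - t) \<ge> 0" if "t \<in> T" for t
      using assms \<open>z \<in> T\<close> that by (simp add: maximal_monotone_def monotone_operator_def)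
    then show "fitzpatrick T z \<le> ereal (coupling z)"
      by (simp add: fitzpatrick_le_coupling_iff)
  qed
  show "ereal (coupling z) \<le> fitzpatrick T z"
    using le[of z] ge[of z] by force
  show "fitzpatrick T z = ereal (coupling z) \<longleftrightarrow> z \<in> T"
    using le[of z] eq[of z] by auto
qed

text \<open>Since the Fitzpatrick function equals \<open>coupling\<close> on \<open>T\<close>,
  restricting the supremum in its conjugate to \<open>T\<close> gives the function back. The
  conjugate therefore dominates it, and with it \<open>coupling\<close>.\<close>

lemma dual_representable_if_maximal_monotone:
  fixes T :: "('a::locally_convex_space \<times> 'a dual) set"
  assumes "maximal_monotone T"
  shows "dual_representable T"
  unfolding dual_representable_def
proof (intro exI conjI allI)
  note eq = fitzpatrick_of_maximal_monotone(2)[OF assms]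
    and ge = fitzpatrick_of_maximal_monotone(1)[OF assms]
  have "T \<noteq> {}"
    \<comment> \<open>If \<open>T\<close> were empty, 0 would be vacuously related to it and so
      belong to it.\<close>
    using maximal_monotone_mem[OF assms, of 0] by auto
  then obtain t where "t \<in> T"
    by blast
  show "proper_fun (fitzpatrick T)"
    unfolding proper_fun_def
  proof (intro conjI allI exI)
    show "fitzpatrick T z \<noteq> -\<infinity>" for z
      using ge[of z] by auto
    show "fitzpatrick T t \<noteq> \<infinity>"
      using eq[of t] \<open>t \<in> T\<close> by simp
  qed
  show "T = {z. fitzpatrick T z = ereal (coupling z)}"
    using eq by blast
  fix z
  have "fitzpatrick T z \<le> square_conj (fitzpatrick T) z"
    unfolding fitzpatrick_def[of T z]
  proof (rule SUP_least)
    fix s assume "s \<in> T"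
    then show "ereal (zdot z s - coupling s) \<le> square_conj (fitzpatrick T) z"
      unfolding square_conj_def using eq[of s] by (intro SUP_upper2[of s]) auto
  qed
  then show "square_conj (fitzpatrick T) z \<ge> ereal (coupling z)"
    using ge order_trans by blast
qed (use fitzpatrick_of_maximal_monotone(1)[OF assms] in
    \<open>auto intro: convex_fun_fitzpatrick lower_semicontinuous_fitzpatrick\<close>)

lemma unique_operator_if_maximal_monotone: "maximal_monotone T \<Longrightarrow> unique_operator T"
  unfolding unique_operator_def maximal_monotone_def by blast

section \<open>Operators with a unique maximal monotone extension\<close>

lemma quadratic_nonneg_near_0:
  fixes d A B :: real
  assumes "d > 0"
  obtains r where "r > 0" "r \<le> 1" "\<And>s. 0 \<le> s \<Longrightarrow> s \<le> r \<Longrightarrow> d + s * A + s\<^sup>2 * B \<ge> 0"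
proof
  \<comment> \<open>The summand \<open>d\<close> keeps \<open>C\<close> positive and the radius
    \<open>d / C\<close> at most 1, so that \<open>s\<^sup>2 \<le> s\<close> bounds the quadratic
    term by a linear one.\<close>
  define C where "C = \<bar>A\<bar> + \<bar>B\<bar> + d"
  have "C > 0"
    using assms by (simp add: C_def)
  show "d / C > 0" "d / C \<le> 1"
    using assms \<open>C > 0\<close> by (auto simp: C_def)
  fix s assume s: "0 \<le> s" "s \<le> d / C"
  then have "s \<le> 1"
    using \<open>d / C \<le> 1\<close> by simp
  have "s * \<bar>A\<bar> + s * \<bar>B\<bar> \<le> s * C"
    using s(1) assms by (simp add: C_def algebra_simps)
  also have "s * C \<le> d"
    using s(2) \<open>C > 0\<close> by (simp add: field_simps)
  finally have "s * \<bar>A\<bar> + s * \<bar>B\<bar> \<le> d" .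
  moreover have "- (s * \<bar>A\<bar>) \<le> s * A"
    using s(1) by (metis abs_ge_minus_self abs_mult abs_of_nonneg minus_le_iff)
  moreover have "- (s * \<bar>B\<bar>) \<le> s\<^sup>2 * B"
  proof -
    have "- (s\<^sup>2 * B) \<le> s\<^sup>2 * \<bar>B\<bar>"
      by (metis abs_ge_minus_self abs_mult abs_of_nonneg zero_le_power2)
    also have "s\<^sup>2 * \<bar>B\<bar> \<le> s * \<bar>B\<bar>"
      using s(1) \<open>s \<le> 1\<close> by (intro mult_right_mono) (auto simp: power2_eq_square mult_left_le)
    finally show ?thesis
      by simp
  qed
  ultimately show "d + s * A + s\<^sup>2 * B \<ge> 0"
    by linarith
qed

text \<open>Letting \<open>s\<close> tend to 0 here takes the place of differentiating along a
  segment.\<close>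

lemma le_0_if_le_small_multiples:
  fixes a b :: real
  assumes "\<And>s. 0 < s \<Longrightarrow> s \<le> 1 \<Longrightarrow> a \<le> - s * b"
  shows "a \<le> 0"
proof -
  have "((\<lambda>s. - s * b) \<longlongrightarrow> - 0 * b) (at_right 0)"
    by (intro tendsto_mult tendsto_minus tendsto_ident_at tendsto_const)
  moreover have "\<forall>\<^sub>F s in at_right 0. a \<le> - s * b"
    using assms by (auto simp: eventually_at_right_field intro!: exI[of _ 1])
  ultimately show ?thesis
    using tendsto_lowerbound trivial_limit_at_right_real by force
qed

text \<open>If some \<open>u\<close> has \<open>coupling (u - t)\<close> bounded away from \<open>0\<close> over \<open>t \<in> T\<close>, then short initial
  pieces of the segments from \<open>u\<close> towards points of the domain of the Fitzpatrick function stay in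
  \<open>M\<close>, so that this domain is itself monotone. Otherwise the Fitzpatrick function dominates
  \<open>coupling\<close>, and one differentiates along the segment from \<open>z\<close> to \<open>w\<close>.\<close>

lemma unique_operator_minorant:
  fixes T :: "('a::locally_convex_space \<times> 'a dual) set"
  assumes mono: "monotone_operator M" and M: "M = {z. \<forall>t\<in>T. coupling (z - t) \<ge> 0}"
    and "z \<in> M" and "fitzpatrick T w \<le> ereal k" and "coupling w \<le> k"
  shows "zdot w z - coupling z \<le> k"
proof (cases "\<exists>u d. d > 0 \<and> (\<forall>t\<in>T. coupling (u - t) \<ge> d)")
  case True
  then obtain u d where u: "d > 0" "\<And>t. t \<in> T \<Longrightarrow> coupling (u - t) \<ge> d"
    by blast
  have near: "\<exists>r. 0 < r \<and> r \<le> 1 \<and> (\<forall>s. 0 \<le> s \<and> s \<le> r \<longrightarrow> u + s *\<^sub>R (v - u) \<in> M)"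
    if v: "fitzpatrick T v \<le> ereal c" for v c
  proof -
    \<comment> \<open>Averaging the bounds at \<open>u\<close> and \<open>v\<close> with weights
      \<open>1 - s\<close> and \<open>s\<close> bounds
      \<open>coupling (u + s *\<^sub>R (v - u) - t)\<close> below by a quadratic in
      \<open>s\<close>, uniformly in \<open>t\<close>. Its constant term is \<open>d\<close> and its
      linear coefficient is \<open>A\<close>.\<close>
    define A where "A = zdot u (v - u) + coupling u - d - c"
    obtain r where r: "r > 0" "r \<le> 1"
      "\<And>s. 0 \<le> s \<Longrightarrow> s \<le> r \<Longrightarrow> d + s * A + s\<^sup>2 * coupling (v - u) \<ge> 0"
      using quadratic_nonneg_near_0[OF u(1)] by blast
    have "coupling (u + s *\<^sub>R (v - u) - t) \<ge> 0" if "0 \<le> s" "s \<le> r" "t \<in> T" for s t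
    proof -
      have "s * (zdot v t - coupling t) \<le> s * c"
        using v that by (intro mult_left_mono) (auto simp: fitzpatrick_le_iff)
      moreover have "(1 - s) * (zdot u t - coupling t) \<le> (1 - s) * (coupling u - d)"
        using u(2)[OF that(3)] that(1,2) r(2) by (intro mult_left_mono) (auto simp: coupling_simps)
      moreover have "d + s * A + s\<^sup>2 * coupling (v - u) \<ge> 0"
        using r(3) that by blast
      ultimately show ?thesis
        unfolding A_def
        by (simp add: coupling_simps zdot_simps zdot_commute[of v u] zdot_commute[of t u]
            algebra_simps power2_eq_square)
    qed
    then show ?thesis
      using r M by blast
  qed
  have "fitzpatrick T z \<le> ereal (coupling z)"
    using \<open>z \<in> M\<close> M by (simp add: fitzpatrick_le_coupling_iff)
  from near[OF this] obtain p where p: "0 < p" "\<And>s. 0 \<le> s \<and> s \<le> p \<Longrightarrow> u + s *\<^sub>R (z - u) \<in> M"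
    by blast
  from near[OF assms(4)] obtain q where q: "0 < q" "\<And>s. 0 \<le> s \<and> s \<le> q \<Longrightarrow> u + s *\<^sub>R (w - u) \<in> M"
    by blast
  \<comment> \<open>Using the same parameter on both segments makes the difference of the two points
    a multiple of \<open>w - z\<close>.\<close>
  define s where "s = min p q"
  have "u + s *\<^sub>R (w - u) \<in> M" "u + s *\<^sub>R (z - u) \<in> M"
    using p(1) q(1) q(2)[of s] p(2)[of s] by (auto simp: s_def)
  then have "coupling ((u + s *\<^sub>R (w - u)) - (u + s *\<^sub>R (z - u))) \<ge> 0"
    using mono unfolding monotone_operator_def by blast
  also have "(u + s *\<^sub>R (w - u)) - (u + s *\<^sub>R (z - u)) = s *\<^sub>R (w - z)"
    by (simp add: algebra_simps)
  finally have "s\<^sup>2 * coupling (w - z) \<ge> 0"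
    by (simp only: coupling_simps(3))
  moreover have "s\<^sup>2 > 0"
    using p(1) q(1) by (simp add: s_def)
  ultimately have "coupling (w - z) \<ge> 0"
    by (simp add: zero_le_mult_iff)
  then show ?thesis
    using assms(5) by (simp add: coupling_simps)
next
  case False
  have "zdot w z - coupling z - k \<le> - s * coupling (w - z)" if s: "0 < s" "s \<le> 1" for s
  proof (rule field_le_epsilon)
    fix e :: real assume "e > 0"
    \<comment> \<open>The failure of the first case is applied at this point of the segment; the
      tolerance \<open>s * e\<close> becomes \<open>e\<close> after division by
      \<open>s\<close>.\<close>
    define v where "v = z + s *\<^sub>R (w - z)"
    obtain t where t: "t \<in> T" "coupling (v - t) < s * e"
      using False \<open>e > 0\<close> s(1) by (meson mult_pos_pos not_le)
    have "s * (zdot w t - coupling t) \<le> s * k"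
      using assms(4) s t(1) by (intro mult_left_mono) (auto simp: fitzpatrick_le_iff)
    moreover have "(1 - s) * (zdot z t - coupling t) \<le> (1 - s) * coupling z"
      using \<open>z \<in> M\<close> M t(1) s by (intro mult_left_mono) (auto simp: coupling_simps)
    ultimately have "s * (zdot w z - coupling z - k) \<le> s * (- s * coupling (w - z) + e)"
      using t(2) unfolding v_def
      by (simp add: coupling_simps zdot_simps zdot_commute[of w z] zdot_commute[of t z]
          algebra_simps power2_eq_square)
    then show "zdot w z - coupling z - k \<le> - s * coupling (w - z) + e"
      using s(1) by (rule mult_left_le_imp_le)
  qed
  then have "zdot w z - coupling z - k \<le> 0"
    by (rule le_0_if_le_small_multiples)
  then show ?thesis
    by simp
qed

lemma fitzpatrick_le_square_conj:
  assumes "\<And>t. t \<in> T \<Longrightarrow> f t = ereal (coupling t)"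
  shows "fitzpatrick T z \<le> square_conj f z"
  unfolding fitzpatrick_def
proof (rule SUP_least)
  fix t assume "t \<in> T"
  then show "ereal (zdot z t - coupling t) \<le> square_conj f z"
    unfolding square_conj_def using assms by (intro SUP_upper2[of t]) auto
qed

text \<open>At \<open>t\<close> the convex function \<open>f\<close> touches \<open>coupling\<close>
  from above. Hence its increment from \<open>t\<close> to \<open>w\<close> is at least the
  derivative of \<open>coupling\<close> at \<open>t\<close> in the direction \<open>w - t\<close>,
  which is \<open>zdot w t - 2 * coupling t\<close>.\<close>

lemma fitzpatrick_le_representative:
  fixes f :: "'a::locally_convex_space \<times> 'a dual \<Rightarrow> ereal"
  assumes "convex_fun f" "\<And>z. ereal (coupling z) \<le> f z"
    and eq: "\<And>t. t \<in> T \<Longrightarrow> f t = ereal (coupling t)"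
  shows "fitzpatrick T w \<le> f w"
proof (cases "f w")
  case (real k)
  have "zdot w t - coupling t \<le> k" if "t \<in> T" for t
  proof -
    have "zdot w t - coupling t - k \<le> - s * coupling (w - t)" if s: "0 < s" "s \<le> 1" for s
    proof -
      have "(1 - s) *\<^sub>R (t, coupling t) + s *\<^sub>R (w, k) \<in> {(z, r). f z \<le> ereal r}"
        using assms(1) s real eq[OF \<open>t \<in> T\<close>] unfolding convex_fun_def
        by (intro convexD) auto
      then have "f (t + s *\<^sub>R (w - t)) \<le> ereal ((1 - s) * coupling t + s * k)"
        by (simp add: algebra_simps)
      then have "coupling (t + s *\<^sub>R (w - t)) \<le> (1 - s) * coupling t + s * k"
        using assms(2)[of "t + s *\<^sub>R (w - t)"] by (metis ereal_less_eq(3) order_trans)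
      then have "s * (zdot w t - coupling t - k) \<le> s * (- s * coupling (w - t))"
        by (simp add: coupling_simps zdot_simps zdot_commute[of w t] algebra_simps power2_eq_square)
      then show ?thesis
        using s(1) by (rule mult_left_le_imp_le)
    qed
    then have "zdot w t - coupling t - k \<le> 0"
      by (rule le_0_if_le_small_multiples)
    then show ?thesis
      by simp
  qed
  then show ?thesis
    by (simp add: real fitzpatrick_le_iff)
qed (use assms(2)[of w] in auto)

lemma maximal_monotone_if_dual_representable_unique:
  fixes T :: "('a::locally_convex_space \<times> 'a dual) set"
  assumes "dual_representable T" "unique_operator T"
  shows "maximal_monotone T"
proof -
  obtain f where f: "proper_fun f" "convex_fun f" "lower_semicontinuous f"
    "\<And>z. ereal (coupling z) \<le> f z" "\<And>z. ereal (coupling z) \<le> square_conj f z"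
    "T = {z. f z = ereal (coupling z)}"
    using assms(1) unfolding dual_representable_def by blast
  have eq: "f t = ereal (coupling t)" if "t \<in> T" for t
    using that f(6) by simp
  obtain M where "maximal_monotone M" "T \<subseteq> M"
    using assms(2) unfolding unique_operator_def by blast
  then have M: "monotone_operator M" "M = {z. \<forall>t\<in>T. coupling (z - t) \<ge> 0}"
    using unique_operator_extension_eq[OF assms(2)] by (auto simp: maximal_monotone_def)
  \<comment> \<open>The function \<open>h\<close> is left general because the bound is needed for
    both \<open>f\<close> and \<open>square_conj f\<close>.\<close>
  have minorant: "ereal (zdot w z - coupling z) \<le> h w"
    if "z \<in> M" "fitzpatrick T w \<le> h w" "ereal (coupling w) \<le> h w" for z w and h :: "_ \<Rightarrow> ereal"
    using unique_operator_minorant[OF M \<open>z \<in> M\<close>, of w] that(2,3) by (cases "h w") auto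
  have "z \<in> T" if "z \<in> M" for z
  proof -
    \<comment> \<open>The Fenchel-Moreau bound is used with slope \<open>u = z\<close> and with both
      constants equal to \<open>coupling z\<close>.\<close>
    have "f z \<le> ereal (coupling z)"
    proof (rule fenchel_moreau_bound[OF f(2,3)])
      show "\<exists>z. f z \<noteq> \<infinity>"
        using f(1) by (simp add: proper_fun_def)
      show "ereal (zdot w z - coupling z) \<le> f w" for w
        using that fitzpatrick_le_representative[OF f(2,4) eq] f(4) by (rule minorant)
      show "ereal (zdot w z - coupling z) \<le> square_conj f w" for w
        using that fitzpatrick_le_square_conj[OF eq] f(5) by (rule minorant)
    qed
    then show ?thesis
      using f(4)[of z] f(6) by simp
  qed
  then show ?thesis
    using \<open>maximal_monotone M\<close> \<open>T \<subseteq> M\<close> by (metis subsetI subset_antisym)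
qed

theorem theorem6:
  fixes T :: "('a::locally_convex_space \<times> 'a dual) set"
  assumes "(UNIV :: 'a set) \<noteq> {0}"
  shows "maximal_monotone T \<longleftrightarrow> dual_representable T \<and> unique_operator T"
  using dual_representable_if_maximal_monotone unique_operator_if_maximal_monotone
    maximal_monotone_if_dual_representable_unique by blast

end
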